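(* Let $\{x_t\}_{t\ge0}$ be a homogeneous stochastic process on $X$ with almost surely continuous sample paths, and let $\{\mathcal{P}_t\}_{t\ge0}$ denote the associated transfer operator semigroup on $L^1=L^1_m$. Let $f\in L^1\cap L^\infty$ be such that $\mathcal{P}_tf=e^{\lambda t}f$ for all $t\ge0$, for some $\lambda<0$. Assume further that $A^{\pm}:=\{\pm f\ge0\}$ is closed. Then $E(A^{\pm})\le-\lambda$.
   Context: $X\subset\mathbb{R}^d$ is a bounded state space and $m$ is Lebesgue measure on $X$. $\{x_t\}$ is a time-homogeneous Markov process on $X$: $\mathbb{P}_{x_s=y}(x_t\in A)=\mathbb{P}_{x_{s+r}=y}(x_{t+r}\in A)$ for every $r\ge0$, $s\le t$ and Borel set $A$. The transfer operator $\mathcal{P}_t:L^1_m\to L^1_m$ is the linear operator mapping a density $f$ of the distribution of $x_0$ to the density $\mathcal{P}_tf$ of the distribution of $x_t$, i.e. $\int_A\mathcal{P}_tf\,dm=\int_X\mathbb{P}_{x_0=y}(x_t\in A)f(y)\,dm(y)$ for all Borel $A$ (these distributions are assumed absolutely continuous with respect to $m$, so that $\mathcal{P}_t$ is defined). The function $f$ is real-valued, with a fixed pointwise representative used to form the sets $A^\pm=\{x\in X:\pm f(x)\ge0\}$. The escape rate from a closed set $A\subset X$ is $$E(A)=-\limsup_{t\to\infty}\frac1t\log\mathbb{P}_{x_0\sim m}\big(x_r\in A\ \forall r\in[0,t]\big),$$ with $\log0=-\infty$ and $x_0\sim m$ meaning that $x_0$ has distribution $m$ (which may be normalized to a probability measure).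 *)

theory Defs
  imports "HOL-Probability.Probability"
begin

definition history :: "'w measure \<Rightarrow> (real \<Rightarrow> 'w \<Rightarrow> 'a::topological_space) \<Rightarrow> real \<Rightarrow> 'w measure" where
  "history M x s = sigma (space M) {x r -` B \<inter> space M | r B. 0 \<le> r \<and> r \<le> s \<and> B \<in> sets borel}"

text \<open>
  The state space \<open>X\<close> carries its Borel sets. The reading of the parameters is:
  \<open>P y\<close> is the law of the process conditioned on \<open>x\<^sub>0 = y\<close>, a measure on the
  sample space \<open>M\<close> (only the sigma-algebra of \<open>M\<close> matters), and
  \<open>measure (K s t y) A\<close> is the probability of \<open>x\<^sub>t \<in> A\<close> given \<open>x\<^sub>s = y\<close>. For \<open>s = 0\<close>
  the two agree, by the axioms \<open>start\<close> and \<open>markov\<close>. Only times \<open>t \<ge> 0\<close> are relevant.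
\<close>
locale homogeneous_markov_process =
  fixes X :: "'a::euclidean_space set"
    and M :: "'w measure"
    and P :: "'a \<Rightarrow> 'w measure"
    and x :: "real \<Rightarrow> 'w \<Rightarrow> 'a"
    and K :: "real \<Rightarrow> real \<Rightarrow> 'a \<Rightarrow> 'a measure"
  assumes state_measurable:
      "\<And>t. 0 \<le> t \<Longrightarrow> x t \<in> M \<rightarrow>\<^sub>M restrict_space borel X"
    and law_kernel:
      "P \<in> restrict_space borel X \<rightarrow>\<^sub>M prob_algebra M"
    and transition_kernel:
      "\<And>s t. 0 \<le> s \<Longrightarrow> s \<le> t \<Longrightarrow>
         K s t \<in> restrict_space borel X \<rightarrow>\<^sub>M prob_algebra (restrict_space borel X)"
    and start:
      "\<And>y. y \<in> X \<Longrightarrow> AE w in P y. x 0 w = y"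
    and markov:
      "\<And>y s t A. y \<in> X \<Longrightarrow> 0 \<le> s \<Longrightarrow> s \<le> t \<Longrightarrow> A \<in> sets (restrict_space borel X) \<Longrightarrow>
         AE w in P y. real_cond_exp (P y) (history M x s) (indicator {v \<in> space M. x t v \<in> A}) w
                      = measure (K s t (x s w)) A"
    and homogeneous:
      "\<And>y s t r A. y \<in> X \<Longrightarrow> 0 \<le> s \<Longrightarrow> s \<le> t \<Longrightarrow> 0 \<le> r \<Longrightarrow>
         A \<in> sets (restrict_space borel X) \<Longrightarrow>
         measure (K s t y) A = measure (K (s + r) (t + r) y) A"

text \<open>
  The law of the process when \<open>x\<^sub>0\<close> is distributed according to Lebesgue measure on \<open>X\<close>,
  normalized to a probability measure.
\<close>
definition lebesgue_start :: "'a::euclidean_space set \<Rightarrow> ('a \<Rightarrow> 'w measure) \<Rightarrow> 'w measure" where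
  "lebesgue_start X P = bind (uniform_measure (lebesgue_on X) X) P"

text \<open>
  The defining property of the transfer operator at time \<open>t\<close>. It determines \<open>T g\<close> up to null
  sets, so \<open>T\<close> is linear as a map on integrable functions modulo null sets. That such a \<open>T\<close>
  exists amounts to absolute continuity of the distribution of \<open>x\<^sub>t\<close> whenever that of
  \<open>x\<^sub>0\<close> has a density.
\<close>
definition transfer_operator ::
  "'a::euclidean_space set \<Rightarrow> 'w measure \<Rightarrow> ('a \<Rightarrow> 'w measure) \<Rightarrow> (real \<Rightarrow> 'w \<Rightarrow> 'a) \<Rightarrow> real
     \<Rightarrow> (('a \<Rightarrow> real) \<Rightarrow> ('a \<Rightarrow> real)) \<Rightarrow> bool" where
  "transfer_operator X M P x t T \<longleftrightarrow>
     (\<forall>g. integrable (lebesgue_on X) g \<longrightarrow>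
        integrable (lebesgue_on X) (T g) \<and>
        (\<forall>A \<in> sets (restrict_space borel X).
           (LINT y:A|lebesgue_on X. T g y)
           = (LINT y|lebesgue_on X. measure (P y) {w \<in> space M. x t w \<in> A} * g y)))"

definition log_prob :: "real \<Rightarrow> ereal" where
  "log_prob p = (if p = 0 then - \<infinity> else ereal (ln p))"

text \<open>
  The event below is an uncountable intersection, hence possibly not measurable. If almost all
  paths are continuous and \<open>A\<close> is closed, it differs from the intersection over rational times
  only within a null set, so it is measurable for the completion.
\<close>
definition escape_rate :: "'w measure \<Rightarrow> (real \<Rightarrow> 'w \<Rightarrow> 'a) \<Rightarrow> 'a set \<Rightarrow> ereal" where
  "escape_rate Q x A =
     - Limsup at_top (\<lambda>t::real. ereal (1 / t) *
         log_prob (measure (completion Q) {w \<in> space Q. \<forall>r \<in> {0..t}. x r w \<in> A}))"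

end

theory Submission
  imports Defs
begin

text \<open>
  Let \<open>A = {f \<ge> 0}\<close> and let \<open>h = max 0 f\<close>. Since \<open>f \<le> h\<close>, positivity of the transfer operator turns the
  eigenvalue equation into \<open>1\<^sub>A P\<^sub>s h \<ge> exp (lam s) h\<close>. Iterating this by the Markov property, the
  process started from the density \<open>h\<close> lies in \<open>A\<close> at all times \<open>0, s, \<dots>, n s\<close> with probability at least
  \<open>exp (lam n s)\<close> times the mass of \<open>h\<close>. As \<open>h\<close> is bounded, the same holds up to a constant for
  the normalized Lebesgue start. Taking \<open>s = t / 2^m\<close> and letting \<open>m\<close> grow, path continuity and
  closedness of \<open>A\<close> give the bound for all times in \<open>[0, t]\<close>. If \<open>h\<close> has mass zero, then
  \<open>\<integral> f = exp lam \<integral> f\<close> forces \<open>f = 0\<close> almost everywhere, so \<open>X - A\<close> is a null set, which by absolute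
  continuity is almost surely never visited.
\<close>

section \<open>The Markov property for events under the laws \<open>P y\<close>\<close>

context homogeneous_markov_process
begin

lemma law_prob_space:
  assumes "y \<in> X"
  shows "prob_space (P y)" and "sets (P y) = sets M" and "space (P y) = space M"
proof -
  have "P y \<in> space (prob_algebra M)"
    using measurable_space[OF law_kernel, of y] assms by (simp add: space_restrict_space)
  then show "prob_space (P y)" "sets (P y) = sets M"
    by (auto simp: space_prob_algebra)
  then show "space (P y) = space M" by (metis sets_eq_imp_space_eq)
qed

lemma transition_prob_space:
  assumes "0 \<le> s" "s \<le> t" "y \<in> X"
  shows "prob_space (K s t y)" and "sets (K s t y) = sets (restrict_space borel X)"
  using measurable_space[OF transition_kernel[OF assms(1,2)], of y] assms(3)
  by (auto simp: space_prob_algebra space_restrict_space)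

lemma state_in: "0 \<le> t \<Longrightarrow> w \<in> space M \<Longrightarrow> x t w \<in> X"
  using measurable_space[OF state_measurable, of t w] by (simp add: space_restrict_space)

lemma state_event:
  "0 \<le> t \<Longrightarrow> B \<in> sets (restrict_space borel X) \<Longrightarrow> {w \<in> space M. x t w \<in> B} \<in> sets M"
  using measurable_sets[OF state_measurable, of t B] by (simp add: vimage_def Int_def conj_commute)

lemma history_subalgebra:
  assumes "y \<in> X"
  shows "subalgebra (P y) (history M x s)"
proof -
  have *: "x r -` B \<inter> space M \<in> sets M" if "0 \<le> r" "B \<in> sets borel" for r B
  proof -
    have "x r \<in> M \<rightarrow>\<^sub>M borel"
      using state_measurable[OF that(1)] by (simp add: measurable_restrict_space2_iff)
    then show ?thesis using that(2) by (rule measurable_sets)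
  qed
  show ?thesis
    unfolding subalgebra_def history_def law_prob_space[OF assms]
    by (auto intro!: sets.sigma_sets_subset simp: space_measure_of_conv * sets_measure_of_conv)
qed

text \<open>\<open>history\<close> is generated by Borel sets of the whole space, whereas events of
  the process use their traces on \<open>X\<close>. Since \<open>x r\<close> takes values in
  \<open>X\<close>, intersecting with \<open>X\<close> changes nothing.\<close>

lemma history_event:
  assumes "0 \<le> r" "r \<le> s" and B: "B \<in> sets (restrict_space borel X)"
  shows "{w \<in> space M. x r w \<in> B} \<in> sets (history M x s)"
proof -
  obtain B' where B': "B' \<in> sets borel" "B = X \<inter> B'"
    using B by (auto simp: sets_restrict_space)
  have "{w \<in> space M. x r w \<in> B} = x r -` B' \<inter> space M"
    using B' state_in[OF assms(1)] by auto
  moreover have "x r -` B' \<inter> space M \<in> sets (history M x s)"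
    unfolding history_def using assms(1,2) B'(1) by (subst sets_measure_of) auto
  ultimately show ?thesis by simp
qed

text \<open>This is the axiom \<open>markov\<close> integrated over \<open>E\<close>. The
  conditional expectation has the same integral as the indicator over every set of the history,
  which replaces an almost sure statement by an identity of numbers.\<close>

lemma measure_history_Int_event:
  assumes y: "y \<in> X" and st: "0 \<le> s" "s \<le> t"
    and E: "E \<in> sets (history M x s)" and B: "B \<in> sets (restrict_space borel X)"
  shows "measure (P y) (E \<inter> {w \<in> space M. x t w \<in> B}) = (\<integral>w\<in>E. measure (K s t (x s w)) B \<partial>P y)"
    (is "measure _ (E \<inter> ?F) = _")
proof -
  interpret prob_space "P y" using law_prob_space[OF y] by simp
  interpret finite_measure_subalgebra "P y" "history M x s"
    by unfold_locales (rule history_subalgebra[OF y])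
  have EM: "E \<in> sets (P y)" using E history_subalgebra[OF y] by (auto simp: subalgebra_def)
  have F: "?F \<in> sets (P y)" using state_event[of t B] st B law_prob_space[OF y] by simp
  have int: "integrable (P y) (indicator ?F :: 'w \<Rightarrow> real)"
    using F by (simp add: integrable_indicator_iff emeasure_eq_measure)
  have [measurable]: "x s \<in> P y \<rightarrow>\<^sub>M restrict_space borel X"
    using state_measurable[OF st(1)] by (simp add: measurable_cong_sets[OF law_prob_space(2)[OF y] refl])
  have [measurable]: "(\<lambda>w. measure (K s t (x s w)) B) \<in> borel_measurable (P y)"
    using measurable_compose[OF measurable_compose[OF \<open>x s \<in> _\<close> transition_kernel[OF st]]
        measurable_measure_prob_algebra[OF B]] by simp
  have "measure (P y) (E \<inter> ?F) = (\<integral>w\<in>E. indicator ?F w \<partial>P y)"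
    unfolding set_lebesgue_integral_def using EM F
    by (simp add: indicator_inter_arith[symmetric] Int_absorb2 sets.sets_into_space)
  also have "\<dots> = (\<integral>w\<in>E. real_cond_exp (P y) (history M x s) (indicator ?F) w \<partial>P y)"
    by (rule real_cond_exp_intA[OF int E])
  also have "\<dots> = (\<integral>w\<in>E. measure (K s t (x s w)) B \<partial>P y)"
    unfolding set_lebesgue_integral_def using EM markov[OF y st B]
    by (intro integral_cong_AE) auto
  finally show ?thesis .
qed

text \<open>Conditioning at time 0 on the whole sample space gives the average of
  \<open>K 0 t (x 0 w)\<close>, and \<open>start\<close> makes this integrand almost surely
  constant.\<close>

lemma transition_eq_law:
  assumes y: "y \<in> X" and t: "0 \<le> t" and B: "B \<in> sets (restrict_space borel X)"
  shows "measure (K 0 t y) B = measure (P y) {w \<in> space M. x t w \<in> B}"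
proof -
  interpret prob_space "P y" using law_prob_space[OF y] by simp
  have X: "{w \<in> space M. x 0 w \<in> X} = space M" using state_in[of 0] by auto
  have E: "space M \<in> sets (history M x 0)"
    using history_event[of 0 0 X] sets.top[of "restrict_space borel X"] X
    by (simp add: space_restrict_space)
  have sp: "space (P y) = space M" using law_prob_space(3)[OF y] .
  have [measurable]: "x 0 \<in> P y \<rightarrow>\<^sub>M restrict_space borel X"
    using state_measurable[of 0] by (simp add: measurable_cong_sets[OF law_prob_space(2)[OF y] refl])
  have [measurable]: "(\<lambda>w. measure (K 0 t (x 0 w)) B) \<in> borel_measurable (P y)"
    using measurable_compose[OF measurable_compose[OF \<open>x 0 \<in> _\<close> transition_kernel[OF order_refl t]]
        measurable_measure_prob_algebra[OF B]] by simp
  have "measure (P y) {w \<in> space M. x t w \<in> B} = (\<integral>w\<in>space M. measure (K 0 t (x 0 w)) B \<partial>P y)"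
    using measure_history_Int_event[OF y order_refl t E B] by (simp add: Int_absorb1 subset_eq)
  also have "\<dots> = (\<integral>w. measure (K 0 t (x 0 w)) B \<partial>P y)"
    unfolding set_lebesgue_integral_def
    by (intro Bochner_Integration.integral_cong) (auto simp: sp)
  also have "\<dots> = (\<integral>w. measure (K 0 t y) B \<partial>P y)"
    using start[OF y] by (intro integral_cong_AE) auto
  finally show ?thesis by (simp add: prob_space)
qed

text \<open>Homogeneity shifts \<open>K s (s + t)\<close> back to \<open>K 0 t\<close>, which is the
  law of \<open>x t\<close> under \<open>P\<close>. The process thus restarts afresh from
  \<open>x s w\<close>. The form with \<open>emeasure\<close> fits nonnegative integrals and needs
  no integrability conditions later.\<close>

lemma emeasure_history_Int_event:
  assumes y: "y \<in> X" and st: "0 \<le> s" "0 \<le> t"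
    and E: "E \<in> sets (history M x s)" and B: "B \<in> sets (restrict_space borel X)"
  shows "emeasure (P y) (E \<inter> {w \<in> space M. x (s + t) w \<in> B})
    = (\<integral>\<^sup>+w\<in>E. emeasure (P (x s w)) {v \<in> space M. x t v \<in> B} \<partial>P y)"
proof -
  interpret prob_space "P y" using law_prob_space[OF y] by simp
  have EM: "E \<in> sets (P y)" using E history_subalgebra[OF y] by (auto simp: subalgebra_def)
  have xs: "x s \<in> P y \<rightarrow>\<^sub>M restrict_space borel X"
    using state_measurable[OF st(1)] by (simp add: measurable_cong_sets[OF law_prob_space(2)[OF y] refl])
  have st': "s \<le> s + t" using st by simp
  have meas: "(\<lambda>w. measure (K s (s + t) (x s w)) B) \<in> borel_measurable (P y)"
    using measurable_compose[OF measurable_compose[OF xs transition_kernel[OF st(1) st']]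
        measurable_measure_prob_algebra[OF B]] by simp
  have le1: "measure (K s (s + t) (x s w)) B \<le> 1" if "w \<in> space (P y)" for w
    using transition_prob_space(1)[OF st(1) st', of "x s w"] state_in[OF st(1), of w] that
    by (simp add: law_prob_space(3)[OF y] prob_space.prob_le_1)
  have "emeasure (P y) (E \<inter> {w \<in> space M. x (s + t) w \<in> B})
      = ennreal (\<integral>w. indicator E w * measure (K s (s + t) (x s w)) B \<partial>P y)"
    using measure_history_Int_event[OF y st(1) st' E B]
    by (simp add: emeasure_eq_measure set_lebesgue_integral_def)
  also have "\<dots> = (\<integral>\<^sup>+w. ennreal (indicator E w * measure (K s (s + t) (x s w)) B) \<partial>P y)"
    using EM meas le1
    by (intro nn_integral_eq_integral[symmetric] integrable_const_bound[where B=1] AE_I2)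
      (auto simp: indicator_def)
  also have "\<dots> = (\<integral>\<^sup>+w\<in>E. emeasure (P (x s w)) {v \<in> space M. x t v \<in> B} \<partial>P y)"
  proof (rule nn_integral_cong)
    fix w assume "w \<in> space (P y)"
    then have z: "x s w \<in> X" using state_in[OF st(1)] law_prob_space(3)[OF y] by simp
    interpret z: prob_space "P (x s w)" using law_prob_space[OF z] by simp
    have "measure (K s (s + t) (x s w)) B = measure (P (x s w)) {v \<in> space M. x t v \<in> B}"
      using homogeneous[OF z order_refl st(2,1) B] transition_eq_law[OF z st(2) B]
      by (simp add: add.commute)
    then show "ennreal (indicator E w * measure (K s (s + t) (x s w)) B)
      = emeasure (P (x s w)) {v \<in> space M. x t v \<in> B} * indicator E w"
      by (auto simp: indicator_def z.emeasure_eq_measure)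
  qed
  finally show ?thesis .
qed

lemma law_event_measurable:
  assumes "E \<in> sets M"
  shows "(\<lambda>y. emeasure (P y) E) \<in> borel_measurable (restrict_space borel X)"
  using measurable_compose[OF measurable_prob_algebraD[OF law_kernel]
      measurable_emeasure_subprob_algebra[OF assms]] .

text \<open>Measurability in the history up to the last grid time, not merely in \<open>M\<close>,
  is what allows conditioning on survival so far.\<close>

lemma history_all_event:
  assumes s: "0 \<le> s" and A: "A \<in> sets (restrict_space borel X)"
  shows "{w \<in> space M. \<forall>k\<le>n. x (real k * s) w \<in> A} \<in> sets (history M x (real n * s))"
proof -
  have "{w \<in> space (history M x (real n * s)). \<forall>k\<in>{..n}. x (real k * s) w \<in> A}
      \<in> sets (history M x (real n * s))"
    using s A history_event[of _ "real n * s" A]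
    by (intro sets.sets_Collect_finite_All') (auto simp: history_def space_measure_of_conv mult_right_mono)
  moreover have "space (history M x (real n * s)) = space M"
    by (simp add: history_def space_measure_of_conv)
  ultimately show ?thesis unfolding Ball_def atMost_iff by (simp only:)
qed

lemma all_event:
  assumes "0 \<le> s" and "A \<in> sets (restrict_space borel X)"
  shows "{w \<in> space M. \<forall>k\<le>n. x (real k * s) w \<in> A} \<in> sets M"
proof -
  have "{w \<in> space M. \<forall>k\<in>{..n}. x (real k * s) w \<in> A} \<in> sets M"
    using assms by (intro sets.sets_Collect_finite_All' state_event) auto
  then show ?thesis unfolding Ball_def atMost_iff .
qed

lemma start_event:
  assumes y: "y \<in> X" and B: "B \<in> sets (restrict_space borel X)"
  shows "emeasure (P y) {w \<in> space M. x 0 w \<in> B} = indicator B y"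
proof -
  interpret prob_space "P y" using law_prob_space[OF y] by simp
  have F: "{w \<in> space M. x 0 w \<in> B} \<in> sets (P y)"
    using state_event[of 0 B] B law_prob_space[OF y] by simp
  show ?thesis
  proof (cases "y \<in> B")
    case True
    have "AE w in P y. w \<in> {w \<in> space M. x 0 w \<in> B}"
      using start[OF y] AE_space by eventually_elim (simp add: True law_prob_space[OF y])
    then show ?thesis
      using True F by (simp add: emeasure_eq_1_AE)
  next
    case False
    have "AE w in P y. w \<notin> {w \<in> space M. x 0 w \<in> B}"
      using start[OF y] by eventually_elim (simp add: False)
    then show ?thesis using False F AE_iff_measurable[OF F, of "\<lambda>w. w \<notin> {w \<in> space M. x 0 w \<in> B}"]
      law_prob_space(3)[OF y] by auto
  qed
qed

section \<open>Survival along a finite time grid\<close>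

text \<open>Induction on the number of steps. The final position is tested against an arbitrary
  \<open>B\<close>, so that the induction hypothesis compares whole measures: \<open>c ^ n\<close>
  times \<open>\<rho>\<close> lies below the distribution of the position at time
  \<open>n * s\<close> on the surviving paths. One further step integrates a nonnegative function
  against both sides.\<close>

lemma survival_lower_bound:
  fixes c :: ennreal
  assumes \<rho>: "sets \<rho> = sets (restrict_space borel X)" and ne: "X \<noteq> {}"
    and s: "0 \<le> s" and A: "A \<in> sets (restrict_space borel X)"
    and supp: "emeasure \<rho> (X - A) = 0"
    and one_step: "\<And>B. B \<in> sets (restrict_space borel X) \<Longrightarrow> B \<subseteq> A \<Longrightarrow>
        c * emeasure \<rho> B \<le> (\<integral>\<^sup>+z. emeasure (P z) {w \<in> space M. x s w \<in> B} \<partial>\<rho>)"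
    and B: "B \<in> sets (restrict_space borel X)"
  shows "c ^ n * emeasure \<rho> B \<le> emeasure (\<rho> \<bind> P)
      ({w \<in> space M. \<forall>k\<le>n. x (real k * s) w \<in> A} \<inter> {w \<in> space M. x (real n * s) w \<in> B})"
  using B
proof (induction n arbitrary: B)
  have sp: "space \<rho> = X"
    using sets_eq_imp_space_eq[OF \<rho>] by (simp add: space_restrict_space)
  have P: "P \<in> \<rho> \<rightarrow>\<^sub>M subprob_algebra M"
    using measurable_prob_algebraD[OF law_kernel] by (simp add: measurable_cong_sets[OF \<rho> refl])
  have bind: "emeasure (\<rho> \<bind> P) E = (\<integral>\<^sup>+y. emeasure (P y) E \<partial>\<rho>)" if "E \<in> sets M" for E
    using emeasure_bind[OF _ P that] sp ne by simp
  have setsQ: "sets (\<rho> \<bind> P) = sets M"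
    using sets_bind_measurable[OF P] sp ne by simp
  \<comment> \<open>Test sets may be cut down to \<open>A\<close>, where \<open>one_step\<close>
    applies, because \<open>\<rho>\<close> has no mass elsewhere.\<close>
  have inA: "emeasure \<rho> (A \<inter> B) = emeasure \<rho> B" if "B \<in> sets (restrict_space borel X)" for B
  proof -
    have "AE y in \<rho>. y \<notin> X - A"
      using supp sets.compl_sets[of A \<rho>] A \<rho> sp by (intro AE_not_in null_setsI) simp_all
    then have "AE y in \<rho>. y \<in> A" using AE_space by eventually_elim (simp add: sp)
    then show ?thesis
      using that A \<rho> by (intro emeasure_eq_AE) auto
  qed
  {
    case 0
    let ?E = "{w \<in> space M. \<forall>k\<le>0::nat. x (real k * s) w \<in> A} \<inter> {w \<in> space M. x (real 0 * s) w \<in> B}"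
    have AB: "A \<inter> B \<in> sets (restrict_space borel X)" using A 0 by blast
    have E: "?E = {w \<in> space M. x 0 w \<in> A \<inter> B}" by auto
    have "emeasure (\<rho> \<bind> P) ?E = (\<integral>\<^sup>+y. indicator (A \<inter> B) y \<partial>\<rho>)"
      unfolding E using start_event[OF _ AB] sp
      by (subst bind[OF state_event[OF order_refl AB]]) (intro nn_integral_cong, auto)
    also have "\<dots> = emeasure \<rho> B" using AB \<rho> inA[OF 0] by simp
    finally show ?case by simp
  next
    case (Suc n)
    define G where "G = {w \<in> space M. \<forall>k\<le>n. x (real k * s) w \<in> A}"
    \<comment> \<open>\<open>\<kappa>\<close> is the chance of stepping from \<open>z\<close> into
      \<open>A \<inter> B\<close>, and \<open>\<nu>\<close> is the distribution of the current
      position restricted to the paths that have survived \<open>n\<close> steps.\<close>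
    define \<kappa> where "\<kappa> z = emeasure (P z) {w \<in> space M. x s w \<in> A \<inter> B}" for z
    define \<nu> where "\<nu> = distr (density (\<rho> \<bind> P) (indicator G)) (restrict_space borel X) (x (real n * s))"
    have ns: "0 \<le> real n * s" using s by simp
    have AB: "A \<inter> B \<in> sets (restrict_space borel X)" using A Suc.prems by blast
    have GM: "G \<in> sets M" unfolding G_def by (rule all_event[OF s A])
    have G: "G \<in> sets (history M x (real n * s))"
      unfolding G_def by (rule history_all_event[OF s A])
    have \<kappa>: "\<kappa> \<in> borel_measurable (restrict_space borel X)"
      unfolding \<kappa>_def by (rule law_event_measurable[OF state_event[OF s AB]])
    have xM: "x (real n * s) \<in> M \<rightarrow>\<^sub>M restrict_space borel X" by (rule state_measurable[OF ns])
    have xQ: "x (real n * s) \<in> (\<rho> \<bind> P) \<rightarrow>\<^sub>M restrict_space borel X"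
      using xM by (simp add: measurable_cong_sets[OF setsQ refl])
    have GQ: "G \<in> sets (\<rho> \<bind> P)" using GM setsQ by simp
    have \<nu>_eq: "emeasure \<nu> C = emeasure (\<rho> \<bind> P) (G \<inter> {w \<in> space M. x (real n * s) w \<in> C})"
      if C: "C \<in> sets (restrict_space borel X)" for C
    proof -
      have F: "{w \<in> space M. x (real n * s) w \<in> C} \<in> sets (\<rho> \<bind> P)"
        using state_event[OF ns C] setsQ by simp
      have "emeasure \<nu> C = emeasure (density (\<rho> \<bind> P) (indicator G)) {w \<in> space M. x (real n * s) w \<in> C}"
        unfolding \<nu>_def using xQ C sets_eq_imp_space_eq[OF setsQ]
        by (subst emeasure_distr) (auto simp: vimage_def Int_def conj_commute)
      also have "\<dots> = (\<integral>\<^sup>+w. indicator (G \<inter> {w \<in> space M. x (real n * s) w \<in> C}) w \<partial>(\<rho> \<bind> P))"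
        unfolding indicator_inter_arith
        by (rule emeasure_density[OF borel_measurable_indicator[OF GQ] F])
      also have "\<dots> = emeasure (\<rho> \<bind> P) (G \<inter> {w \<in> space M. x (real n * s) w \<in> C})"
        using F GQ by (intro nn_integral_indicator) auto
      finally show ?thesis .
    qed
    \<comment> \<open>The induction hypothesis, taken over all test sets, is exactly this order
      between measures, and nonnegative integrals respect it.\<close>
    have le: "scale_measure (c ^ n) \<rho> \<le> \<nu>"
      using Suc.IH \<nu>_eq \<rho> by (subst le_measure) (auto simp: \<nu>_def G_def)
    have E: "{w \<in> space M. \<forall>k\<le>Suc n. x (real k * s) w \<in> A} \<inter> {w \<in> space M. x (real (Suc n) * s) w \<in> B}
      = G \<inter> {w \<in> space M. x (real n * s + s) w \<in> A \<inter> B}"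
      unfolding G_def by (auto simp: le_Suc_eq algebra_simps)
    have "c ^ Suc n * emeasure \<rho> B = c ^ n * (c * emeasure \<rho> (A \<inter> B))"
      using inA[OF Suc.prems] by (simp add: mult_ac)
    also have "\<dots> \<le> c ^ n * (\<integral>\<^sup>+z. \<kappa> z \<partial>\<rho>)"
      unfolding \<kappa>_def by (intro mult_left_mono one_step AB) auto
    also have "\<dots> = (\<integral>\<^sup>+z. \<kappa> z \<partial>scale_measure (c ^ n) \<rho>)"
      using \<kappa> by (intro nn_integral_scale_measure[symmetric]) (simp add: measurable_cong_sets[OF \<rho> refl])
    also have "\<dots> \<le> (\<integral>\<^sup>+z. \<kappa> z \<partial>\<nu>)"
      using le \<rho> by (intro nn_integral_mono_measure) (auto simp: \<nu>_def)
    also have "\<dots> = (\<integral>\<^sup>+w. indicator G w * \<kappa> (x (real n * s) w) \<partial>(\<rho> \<bind> P))"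
      unfolding \<nu>_def using xQ \<kappa> GQ measurable_compose[OF xQ \<kappa>]
      by (simp add: nn_integral_distr nn_integral_density)
    also have "\<dots> = (\<integral>\<^sup>+y. \<integral>\<^sup>+w. indicator G w * \<kappa> (x (real n * s) w) \<partial>P y \<partial>\<rho>)"
      using GM measurable_compose[OF xM \<kappa>] by (intro nn_integral_bind[OF _ P]) auto
    also have "\<dots> = (\<integral>\<^sup>+y. emeasure (P y) (G \<inter> {w \<in> space M. x (real n * s + s) w \<in> A \<inter> B}) \<partial>\<rho>)"
      unfolding \<kappa>_def using emeasure_history_Int_event[OF _ ns s G AB] sp
      by (intro nn_integral_cong) (simp add: mult.commute)
    also have "\<dots> = emeasure (\<rho> \<bind> P) (G \<inter> {w \<in> space M. x (real n * s + s) w \<in> A \<inter> B})"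
      using GM state_event[of "real n * s + s", OF _ AB] ns s by (intro bind[symmetric]) auto
    finally show ?case unfolding E .
  }
qed

end

section \<open>From dyadic grids to all times, and from survival bounds to escape rates\<close>

text \<open>The grid events decrease, so continuity from above carries the bound to their
  intersection. A continuous path in that intersection stays in \<open>A\<close> throughout, as
  dyadic multiples of \<open>t\<close> are dense in the interval and \<open>A\<close> is relatively
  closed. Hence the event for all times differs from a measurable one only inside a null
  set.\<close>

lemma measure_all_times_ge:
  fixes x :: "real \<Rightarrow> 'w \<Rightarrow> 'a::metric_space"
  assumes Q: "finite_measure Q"
    and cont: "AE w in Q. continuous_on {0..} (\<lambda>t. x t w)"
    and A: "closedin (top_of_set X) A"
    and X: "\<And>r w. 0 \<le> r \<Longrightarrow> w \<in> space Q \<Longrightarrow> x r w \<in> X"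
    and meas: "\<And>r. 0 \<le> r \<Longrightarrow> {w \<in> space Q. x r w \<in> A} \<in> sets Q"
    and t: "0 < t"
    and ge: "\<And>m. p \<le> measure Q {w \<in> space Q. \<forall>k\<le>2 ^ m. x (real k * (t / 2 ^ m)) w \<in> A}"
  shows "p \<le> measure (completion Q) {w \<in> space Q. \<forall>r\<in>{0..t}. x r w \<in> A}"
proof -
  interpret finite_measure Q by fact
  define G where "G m = {w \<in> space Q. \<forall>k\<le>2 ^ m. x (real k * (t / 2 ^ m)) w \<in> A}" for m :: nat
  define S where "S = {w \<in> space Q. \<forall>r\<in>{0..t}. x r w \<in> A}"
  obtain F where F: "closed F" "A = X \<inter> F" using A by (auto simp: closedin_closed)
  have Gm: "G m \<in> sets Q" for m
  proof -
    have "{w \<in> space Q. \<forall>k\<in>{..2 ^ m}. x (real k * (t / 2 ^ m)) w \<in> A} \<in> sets Q"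
      using t by (intro sets.sets_Collect_finite_All' meas) auto
    then show ?thesis unfolding Ball_def atMost_iff G_def .
  qed
  \<comment> \<open>The grids are nested: point \<open>k\<close> of one level is point
    \<open>2 * k\<close> of the next.\<close>
  have "G (Suc m) \<subseteq> G m" for m
  proof
    fix w assume w: "w \<in> G (Suc m)"
    have "x (real k * (t / 2 ^ m)) w \<in> A" if "k \<le> 2 ^ m" for k :: nat
    proof -
      have "2 * k \<le> 2 ^ Suc m" using that by simp
      then have "x (real (2 * k) * (t / 2 ^ Suc m)) w \<in> A" using w unfolding G_def by blast
      then show ?thesis by simp
    qed
    then show "w \<in> G m" using w by (simp add: G_def)
  qed
  then have "(\<lambda>m. measure Q (G m)) \<longlonglongrightarrow> measure Q (\<Inter>m. G m)"
    using Gm by (intro finite_Lim_measure_decseq decseq_SucI) auto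
  then have p: "p \<le> measure Q (\<Inter>m. G m)"
    by (rule LIMSEQ_le_const) (use ge in \<open>auto simp: G_def\<close>)
  have sub: "S \<subseteq> (\<Inter>m. G m)"
  proof
    fix w assume w: "w \<in> S"
    have "x (real k * (t / 2 ^ m)) w \<in> A" if "k \<le> 2 ^ m" for k m :: nat
    proof -
      have "real k \<le> 2 ^ m" using that by (metis of_nat_le_iff of_nat_numeral of_nat_power)
      then have "real k * (t / 2 ^ m) \<in> {0..t}" using t by (simp add: field_simps)
      then show ?thesis using w unfolding S_def by blast
    qed
    then show "w \<in> (\<Inter>m. G m)" using w by (auto simp: S_def G_def)
  qed
  have in_S: "w \<in> S" if w: "w \<in> (\<Inter>m. G m)" and c: "continuous_on {0..} (\<lambda>t. x t w)" for w
  proof -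
    have wsp: "w \<in> space Q" using w by (auto simp: G_def)
    have "x r w \<in> A" if r: "r \<in> {0..t}" for r
    proof -
      \<comment> \<open>\<open>d m\<close> is the last grid time of level \<open>m\<close> not
        exceeding \<open>r\<close>, hence within one mesh width of \<open>r\<close>.\<close>
      define k where "k m = nat \<lfloor>r * 2 ^ m / t\<rfloor>" for m :: nat
      define d where "d m = real (k m) * (t / 2 ^ m)" for m
      have k_le: "real (k m) \<le> r * 2 ^ m / t" and k_ge: "r * 2 ^ m / t < real (k m) + 1" for m
        using r t unfolding k_def by (auto simp: of_nat_nat)
      have "r * 2 ^ m / t \<le> 2 ^ m" for m :: nat
        using r t by (simp add: divide_le_eq mult.commute)
      then have "real (k m) \<le> 2 ^ m" for m
        using k_le[of m] by (rule order_trans[rotated])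
      then have "k m \<le> 2 ^ m" for m by (metis of_nat_le_iff of_nat_numeral of_nat_power)
      then have dF: "x (d m) w \<in> F" for m
        using w F unfolding G_def d_def by blast
      have d_close: "\<bar>d m - r\<bar> \<le> t / 2 ^ m" for m
      proof -
        have q: "0 < t / 2 ^ m" and r_eq: "r * 2 ^ m / t * (t / 2 ^ m) = r" using t by simp_all
        have "d m \<le> r"
          using mult_right_mono[OF k_le[of m], of "t / 2 ^ m"] q unfolding d_def r_eq by simp
        moreover have "r \<le> d m + t / 2 ^ m"
          using mult_right_mono[OF less_imp_le[OF k_ge[of m]], of "t / 2 ^ m"] q
          unfolding d_def r_eq by (simp add: distrib_right add_divide_distrib)
        ultimately show ?thesis by linarith
      qed
      have lim0: "(\<lambda>m. t / 2 ^ m) \<longlonglongrightarrow> 0"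
        by (rule LIMSEQ_divide_realpow_zero) simp
      have "(\<lambda>m. d m - r) \<longlonglongrightarrow> 0"
        by (rule Lim_null_comparison[OF always_eventually[OF allI] lim0])
          (simp only: real_norm_def d_close)
      then have "d \<longlonglongrightarrow> r" by (simp add: LIM_zero_iff)
      moreover have "d m \<in> {0..}" for m using t by (simp add: d_def)
      ultimately have "(\<lambda>m. x (d m) w) \<longlonglongrightarrow> x r w"
        using continuous_on_tendsto_compose[OF c, of d r] r by auto
      \<comment> \<open>Because \<open>A\<close> is closed only relative to \<open>X\<close>, the
        limit is taken in the closed set \<open>F\<close>, and membership in \<open>X\<close> is
        added separately.\<close>
      then have "x r w \<in> F"
        by (rule closed_sequentially[OF F(1) dF])
      then show ?thesis using X[OF _ wsp, of r] r F by auto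
    qed
    then show ?thesis using wsp by (simp add: S_def)
  qed
  obtain N where N: "N \<in> null_sets Q" "{w \<in> space Q. \<not> continuous_on {0..} (\<lambda>t. x t w)} \<subseteq> N"
    using cont by (auto simp: eventually_ae_filter)
  have "(\<Inter>m. G m) - S \<subseteq> N" using in_S N(2) by (auto simp: G_def)
  \<comment> \<open>The difference is known only to lie inside a null set, so it is a null set of
    the completion.\<close>
  then have null: "(\<Inter>m. G m) - S \<in> null_sets (completion Q)"
    using N(1) null_sets_completion_iff2 by blast
  have D: "(\<Inter>m. G m) \<in> sets Q" using Gm by auto
  have "measure (completion Q) S = measure (completion Q) ((\<Inter>m. G m) - ((\<Inter>m. G m) - S))"
    using sub by (simp add: double_diff)
  also have "\<dots> = measure Q (\<Inter>m. G m)"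
    using null D by (simp add: measure_Diff_null_set)
  finally show ?thesis using p by (simp add: S_def)
qed

text \<open>After taking logarithms and dividing by \<open>t\<close>, the prefactor contributes
  \<open>ln c / t\<close>, which vanishes in the limit.\<close>

lemma escape_rate_le:
  assumes c: "0 < c"
    and ge: "\<And>t. 0 < t \<Longrightarrow>
      c * exp (l * t) \<le> measure (completion Q) {w \<in> space Q. \<forall>r\<in>{0..t}. x r w \<in> A}"
  shows "escape_rate Q x A \<le> ereal (- l)"
proof -
  define p where "p t = measure (completion Q) {w \<in> space Q. \<forall>r\<in>{0..t}. x r w \<in> A}" for t
  have "((\<lambda>t. ln c / t + l) \<longlongrightarrow> 0 + l) at_top"
    by (intro tendsto_add tendsto_const tendsto_divide_0[OF tendsto_const] filterlim_at_top_imp_at_infinity filterlim_ident)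
  then have "Limsup at_top (\<lambda>t::real. ereal (ln c / t + l)) = ereal l"
    by (intro lim_imp_Limsup) auto
  moreover have "Limsup at_top (\<lambda>t::real. ereal (ln c / t + l))
      \<le> Limsup at_top (\<lambda>t. ereal (1 / t) * log_prob (p t))"
  proof (intro Limsup_mono eventually_mono[OF eventually_gt_at_top[of 0]])
    fix t :: real assume t: "0 < t"
    have pos: "0 < c * exp (l * t)" using c by simp
    then have "ln (c * exp (l * t)) \<le> ln (p t)"
      using ge[OF t] by (subst ln_le_cancel_iff) (auto simp: p_def)
    then have "(ln c + l * t) / t \<le> ln (p t) / t"
      using c t by (intro divide_right_mono) (auto simp: ln_mult)
    \<comment> \<open>This excludes the branch of \<open>log_prob\<close> with value minus
      infinity.\<close>
    moreover have "p t \<noteq> 0" using ge[OF t] pos by (auto simp: p_def)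
    ultimately show "ereal (ln c / t + l) \<le> ereal (1 / t) * log_prob (p t)"
      using t by (simp add: log_prob_def add_divide_distrib)
  qed
  ultimately show ?thesis
    unfolding escape_rate_def p_def by (simp add: ereal_uminus_le_reorder)
qed

section \<open>Borel and Lebesgue structure on \<open>X\<close>, and the Lebesgue start\<close>

lemma sets_lebesgue_on_if_borel:
  assumes "B \<in> sets (restrict_space borel X)"
  shows "B \<in> sets (lebesgue_on X)"
proof -
  have "sets borel \<subseteq> sets (lebesgue :: 'a measure)"
    by (metis sets_completionI_sets sets_lborel subsetI)
  then have "(\<inter>) X ` sets borel \<subseteq> (\<inter>) X ` sets lebesgue" by (rule image_mono)
  then show ?thesis using assms unfolding sets_restrict_space by (rule subsetD)
qed

text \<open>The process lives on the trace of the Borel sets, while densities live on Lebesgue sets.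
  Composition with this identity map transports kernels and functions from the former setting to the
  latter.\<close>

lemma measurable_lebesgue_on_borel:
  "(\<lambda>y. y) \<in> lebesgue_on X \<rightarrow>\<^sub>M restrict_space borel X"
proof (rule measurableI)
  show "y \<in> space (restrict_space borel X)" if "y \<in> space (lebesgue_on X)" for y
    using that by (simp add: space_restrict_space)
  show "(\<lambda>y. y) -` B \<inter> space (lebesgue_on X) \<in> sets (lebesgue_on X)"
    if B: "B \<in> sets (restrict_space borel X)" for B
    using sets.Int_space_eq2[OF sets_lebesgue_on_if_borel[OF B]] sets_lebesgue_on_if_borel[OF B]
    by (simp only: vimage_ident)
qed

context homogeneous_markov_process
begin

lemma measurable_from_lebesgue_on:
  "g \<in> borel_measurable (restrict_space borel X) \<Longrightarrow> g \<in> borel_measurable (lebesgue_on X)"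
  using measurable_compose[OF measurable_lebesgue_on_borel] by blast

lemma law_lebesgue_measurable: "P \<in> lebesgue_on X \<rightarrow>\<^sub>M subprob_algebra M"
  using measurable_compose[OF measurable_lebesgue_on_borel measurable_prob_algebraD[OF law_kernel]] .

lemma emeasure_lebesgue_start:
  assumes "X \<in> sets lebesgue" "X \<noteq> {}" "E \<in> sets M"
  shows "emeasure (lebesgue_start X P) E
    = (\<integral>\<^sup>+y. emeasure (P y) E \<partial>lebesgue_on X) / emeasure lebesgue X"
proof -
  have P: "P \<in> uniform_measure (lebesgue_on X) X \<rightarrow>\<^sub>M subprob_algebra M"
    using law_lebesgue_measurable by (simp add: measurable_cong_sets[OF sets_uniform_measure refl])
  have XL: "X \<in> sets (lebesgue_on X)" using assms(1) by (simp add: sets_restrict_space_iff)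
  have "emeasure (lebesgue_start X P) E = (\<integral>\<^sup>+y. emeasure (P y) E \<partial>uniform_measure (lebesgue_on X) X)"
    unfolding lebesgue_start_def using assms by (intro emeasure_bind[OF _ P]) auto
  also have "\<dots> = (\<integral>\<^sup>+y. emeasure (P y) E * indicator X y \<partial>lebesgue_on X) / emeasure (lebesgue_on X) X"
    using XL measurable_from_lebesgue_on[OF law_event_measurable[OF assms(3)]]
    by (intro nn_integral_uniform_measure) auto
  also have "(\<integral>\<^sup>+y. emeasure (P y) E * indicator X y \<partial>lebesgue_on X) = (\<integral>\<^sup>+y. emeasure (P y) E \<partial>lebesgue_on X)"
    by (intro nn_integral_cong) (simp add: space_restrict_space)
  also have "emeasure (lebesgue_on X) X = emeasure lebesgue X"
    using assms(1) by (simp add: emeasure_restrict_space)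
  finally show ?thesis .
qed

lemma lebesgue_start_space:
  assumes "X \<noteq> {}"
  shows "sets (lebesgue_start X P) = sets M" "space (lebesgue_start X P) = space M"
proof -
  have P: "P \<in> uniform_measure (lebesgue_on X) X \<rightarrow>\<^sub>M subprob_algebra M"
    using law_lebesgue_measurable by (simp add: measurable_cong_sets[OF sets_uniform_measure refl])
  show "sets (lebesgue_start X P) = sets M"
    unfolding lebesgue_start_def using assms by (intro sets_bind_measurable[OF P]) simp
  then show "space (lebesgue_start X P) = space M" by (rule sets_eq_imp_space_eq)
qed

section \<open>The escape bound for the nonnegative set of an eigenfunction\<close>

text \<open>The eigenvalue equation enters in the integrated form \<open>transfer\<close>, which is
  linear in \<open>f\<close>, so that the lemma serves \<open>f\<close> and its negative alike.
  Absolute continuity enters as \<open>null\<close> and settles the case in which the positive part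
  of \<open>f\<close> vanishes almost everywhere.\<close>

lemma escape_rate_nonneg_set_le:
  fixes f :: "'a \<Rightarrow> real" and l :: real
  assumes X: "X \<in> sets lebesgue" "0 < emeasure lebesgue X" "emeasure lebesgue X < \<infinity>"
    and cont: "AE w in lebesgue_start X P. continuous_on {0..} (\<lambda>t. x t w)"
    and f: "integrable (lebesgue_on X) f"
    and bnd: "AE y in lebesgue_on X. \<bar>f y\<bar> \<le> C"
    and cl: "closedin (top_of_set X) {y \<in> X. 0 \<le> f y}"
    and transfer: "\<And>t B. 0 \<le> t \<Longrightarrow> B \<in> sets (restrict_space borel X) \<Longrightarrow>
        exp (l * t) * (LINT y:B|lebesgue_on X. f y)
        = (LINT y|lebesgue_on X. measure (P y) {w \<in> space M. x t w \<in> B} * f y)"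
    and null: "\<And>t B. 0 \<le> t \<Longrightarrow> B \<in> sets (restrict_space borel X) \<Longrightarrow> emeasure lebesgue B = 0 \<Longrightarrow>
        AE y in lebesgue_on X. emeasure (P y) {w \<in> space M. x t w \<in> B} = 0"
    and l: "l < 0"
  shows "escape_rate (lebesgue_start X P) x {y \<in> X. 0 \<le> f y} \<le> ereal (- l)"
proof -
  define A where "A = {y \<in> X. 0 \<le> f y}"
  define Q where "Q = lebesgue_start X P"
  let ?L = "lebesgue_on X" and ?R = "restrict_space borel X"
  have ne: "X \<noteq> {}" using X(2) by auto
  have setsQ: "sets Q = sets M" and spQ: "space Q = space M"
    unfolding Q_def using lebesgue_start_space[OF ne] by auto
  have Q: "emeasure Q E = (\<integral>\<^sup>+y. emeasure (P y) E \<partial>?L) / emeasure lebesgue X" if "E \<in> sets M" for E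
    unfolding Q_def by (rule emeasure_lebesgue_start[OF X(1) ne that])
  have spL: "space ?L = X" by (simp add: space_restrict_space)
  have eL: "emeasure ?L B = emeasure lebesgue B" if "B \<subseteq> X" for B
    using that X(1) by (simp add: emeasure_restrict_space)
  have "emeasure Q (space M) = 1"
  proof -
    have "(\<integral>\<^sup>+y. emeasure (P y) (space M) \<partial>?L) = (\<integral>\<^sup>+y. 1 \<partial>?L)"
    proof (rule nn_integral_cong)
      fix y assume "y \<in> space ?L"
      then show "emeasure (P y) (space M) = 1"
        using law_prob_space(1,3)[of y] prob_space.emeasure_space_1[of "P y"] by (simp add: spL)
    qed
    also have "\<dots> = emeasure lebesgue X" by (simp add: spL eL)
    finally show ?thesis using Q[of "space M"] X by (simp add: ennreal_divide_self)
  qed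
  then interpret Q: prob_space Q by (intro prob_spaceI) (simp add: spQ)
  obtain F where F: "closed F" "A = X \<inter> F"
    using cl by (auto simp: closedin_closed A_def)
  then have A: "A \<in> sets ?R" by (auto simp: sets_restrict_space)
  have XR: "X \<in> sets ?R" using sets.top[of ?R] by (simp add: space_restrict_space)
  have XA: "X - A \<in> sets ?R" using XR A by blast
  have [measurable]: "f \<in> borel_measurable ?L" using f by simp
  have law[measurable]: "(\<lambda>y. emeasure (P y) E) \<in> borel_measurable ?L" if "E \<in> sets M" for E
    using that by (intro measurable_from_lebesgue_on law_event_measurable)
  have prob_le: "measure (P y) E \<le> 1" if "y \<in> X" for y E
    using law_prob_space(1)[OF that] by (rule prob_space.prob_le_1)
  have law_emeasure: "emeasure (P y) E = ennreal (measure (P y) E)" if "y \<in> X" for y E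
    using law_prob_space(1)[OF that]
    by (simp add: finite_measure.emeasure_eq_measure prob_space.finite_measure)
  define G where "G s n = {w \<in> space M. \<forall>k\<le>n. x (real k * s) w \<in> A}" for s and n :: nat
  have G_event: "G s n \<in> sets M" if "0 \<le> s" for s n
    unfolding G_def by (rule all_event[OF that A])
  define h where "h y = max 0 (f y)" for y
  have h: "integrable ?L h" unfolding h_def using f by simp
  have [measurable]: "h \<in> borel_measurable ?L" using h by simp
  have h0: "0 \<le> h y" "f y \<le> h y" for y by (auto simp: h_def)
  define a where "a = (LINT y|?L. h y)"
  have a0: "0 \<le> a" unfolding a_def using h0 by simp
  \<comment> \<open>The constant must be uniform in both the step and the number of steps: the mesh
    is refined for fixed \<open>t\<close>, and only then does \<open>t\<close> grow.\<close>
  have "\<exists>c>0. \<forall>s\<ge>0. \<forall>n. c * exp (l * (real n * s))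
      \<le> measure Q (G s n)"
  proof (cases "a = 0")
    case True
    have "AE y in ?L. h y = 0"
      using True h h0 unfolding a_def by (subst integral_nonneg_eq_0_iff_AE[symmetric]) auto
    then have fle: "AE y in ?L. f y \<le> 0" by eventually_elim (simp add: h_def split: if_splits)
    \<comment> \<open>Conservation of mass: testing at time 1 with the whole of \<open>X\<close>,
      every transition probability is 1. As \<open>exp l\<close> is not 1, the integral of
      \<open>f\<close> vanishes, and with \<open>fle\<close> so does \<open>f\<close> almost
      everywhere.\<close>
    have "exp l * (LINT y|?L. f y) = (LINT y|?L. f y)"
    proof -
      have "(LINT y:X|?L. f y) = (LINT y|?L. f y)"
        unfolding set_lebesgue_integral_def
        by (intro Bochner_Integration.integral_cong) (auto simp: spL)
      moreover have "(LINT y|?L. measure (P y) {w \<in> space M. x 1 w \<in> X} * f y) = (LINT y|?L. f y)"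
      proof (intro Bochner_Integration.integral_cong refl)
        fix y assume "y \<in> space ?L"
        then have y: "y \<in> X" by (simp add: spL)
        have "{w \<in> space M. x 1 w \<in> X} = space (P y)"
          using state_in[of 1] law_prob_space(3)[OF y] by auto
        then show "measure (P y) {w \<in> space M. x 1 w \<in> X} * f y = f y"
          using law_prob_space(1)[OF y] by (simp add: prob_space.prob_space)
      qed
      ultimately show ?thesis using transfer[of 1 X] XR by simp
    qed
    then have "(LINT y|?L. f y) = 0" using l by (metis exp_eq_one_iff less_irrefl mult_cancel_right1)
    then have "(LINT y|?L. - f y) = 0" by simp
    then have "AE y in ?L. - f y = 0"
      using f fle by (subst integral_nonneg_eq_0_iff_AE[symmetric]) (auto simp del: integral_minus)
    then have "AE y in ?L. y \<notin> X - A" by eventually_elim (auto simp: A_def)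
    then have "emeasure ?L (X - A) = 0"
      using sets_lebesgue_on_if_borel[OF XA]
      by (subst (asm) AE_iff_measurable[of "X - A"]) (auto simp: spL)
    then have n0: "emeasure lebesgue (X - A) = 0" by (simp add: eL)
    have AE_A: "AE w in Q. x t w \<in> A" if t: "0 \<le> t" for t
    proof -
      have E: "{w \<in> space M. x t w \<in> X - A} \<in> sets M" by (rule state_event[OF t XA])
      have "(\<integral>\<^sup>+y. emeasure (P y) {w \<in> space M. x t w \<in> X - A} \<partial>?L) = 0"
        using null[OF t XA n0] nn_integral_0_iff_AE[OF law[OF E]] by blast
      then have "emeasure Q {w \<in> space M. x t w \<in> X - A} = 0" using Q[OF E] by simp
      then show ?thesis
        using E setsQ spQ state_in[OF t] by (subst AE_iff_measurable[of "{w \<in> space M. x t w \<in> X - A}"]) auto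
    qed
    \<comment> \<open>Survival at finitely many times is almost sure here, so \<open>c = 1\<close>
      suffices because the exponential is at most 1.\<close>
    have "1 * exp (l * (real n * s)) \<le> measure Q (G s n)"
      if s: "0 \<le> s" for s n
    proof -
      have "AE w in Q. \<forall>k\<in>{..n}. x (real k * s) w \<in> A"
        using s by (intro AE_finite_allI AE_A) auto
      then have "AE w in Q. w \<in> G s n"
        using AE_space by eventually_elim (simp add: G_def spQ)
      then have "measure Q (G s n) = 1"
        using Q.prob_eq_1[of "G s n"] G_event[OF s] setsQ by simp
      moreover have "exp (l * (real n * s)) \<le> 1"
        using l s by (simp add: mult_nonpos_nonneg)
      ultimately show ?thesis by simp
    qed
    then show ?thesis by (intro exI[of _ 1]) auto
  next
    case False
    then have a: "0 < a" using a0 by simp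
    \<comment> \<open>The measure with density \<open>h\<close>, pushed to the Borel sets of
      \<open>X\<close>, where \<open>P\<close> is a measurable kernel.\<close>
    define \<rho> where "\<rho> = distr (density ?L (\<lambda>y. ennreal (h y))) ?R (\<lambda>y. y)"
    have \<rho>: "sets \<rho> = sets ?R" by (simp add: \<rho>_def)
    have P\<rho>: "P \<in> \<rho> \<rightarrow>\<^sub>M subprob_algebra M"
      using measurable_prob_algebraD[OF law_kernel] by (simp add: measurable_cong_sets[OF \<rho> refl])
    have id[measurable]: "(\<lambda>y. y) \<in> density ?L (\<lambda>y. ennreal (h y)) \<rightarrow>\<^sub>M ?R"
      using measurable_lebesgue_on_borel by (simp add: measurable_cong_sets[OF sets_density refl])
    have \<rho>_int: "(\<integral>\<^sup>+z. g z \<partial>\<rho>) = (\<integral>\<^sup>+y. ennreal (h y) * g y \<partial>?L)"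
      if g: "g \<in> borel_measurable ?R" for g
      unfolding \<rho>_def using g measurable_from_lebesgue_on[OF g]
      by (simp add: nn_integral_distr[OF id] nn_integral_density)
    have \<rho>_B: "emeasure \<rho> B = ennreal (LINT y:B|?L. h y)" if B: "B \<in> sets ?R" for B
    proof -
      have "emeasure \<rho> B = (\<integral>\<^sup>+z. indicator B z \<partial>\<rho>)" using B by (simp add: \<rho>)
      also have "\<dots> = (\<integral>\<^sup>+y. ennreal (h y) * indicator B y \<partial>?L)" using B by (intro \<rho>_int) auto
      also have "\<dots> = (\<integral>\<^sup>+y. ennreal (indicator B y * h y) \<partial>?L)"
        by (intro nn_integral_cong) (auto simp: indicator_def)
      also have "\<dots> = ennreal (LINT y:B|?L. h y)"
        unfolding set_lebesgue_integral_def using h h0 sets_lebesgue_on_if_borel[OF B]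
        by (subst nn_integral_eq_integral) (auto simp: integrable_mult_indicator[where 'b=real, simplified])
      finally show ?thesis .
    qed
    have \<rho>_X: "emeasure \<rho> X = ennreal a"
      unfolding \<rho>_B[OF XR] a_def set_lebesgue_integral_def
      by (intro arg_cong[where f=ennreal] Bochner_Integration.integral_cong) (auto simp: spL)
    have supp: "emeasure \<rho> (X - A) = 0"
    proof -
      have "(LINT y:X - A|?L. h y) = (LINT y|?L. 0)"
        unfolding set_lebesgue_integral_def
        by (intro Bochner_Integration.integral_cong) (auto simp: h_def A_def indicator_def)
      then show ?thesis by (simp add: \<rho>_B[OF XA])
    qed
    have one_step: "ennreal (exp (l * s)) * emeasure \<rho> B
        \<le> (\<integral>\<^sup>+z. emeasure (P z) {w \<in> space M. x s w \<in> B} \<partial>\<rho>)"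
      if s: "0 \<le> s" and B: "B \<in> sets ?R" "B \<subseteq> A" for s B
    proof -
      have E: "{w \<in> space M. x s w \<in> B} \<in> sets M" by (rule state_event[OF s B(1)])
      have "(\<lambda>y. enn2real (emeasure (P y) {w \<in> space M. x s w \<in> B})) \<in> borel_measurable ?L"
        using law[OF E] by simp
      then have [measurable]: "(\<lambda>y. measure (P y) {w \<in> space M. x s w \<in> B}) \<in> borel_measurable ?L"
        by (simp add: measure_def)
      have int: "integrable ?L (\<lambda>y. measure (P y) {w \<in> space M. x s w \<in> B} * g y)"
        if g: "integrable ?L g" for g :: "'a \<Rightarrow> real"
      proof (rule Bochner_Integration.integrable_bound[OF g])
        show "(\<lambda>y. measure (P y) {w \<in> space M. x s w \<in> B} * g y) \<in> borel_measurable ?L"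
          using g by simp
        show "AE y in ?L. norm (measure (P y) {w \<in> space M. x s w \<in> B} * g y) \<le> norm (g y)"
          using prob_le by (intro AE_I2) (auto simp: spL abs_mult intro!: mult_left_le_one_le)
      qed
      \<comment> \<open>On \<open>B\<close>, a subset of \<open>A\<close>, the functions
        \<open>h\<close> and \<open>f\<close> agree, so the eigenvalue identity for \<open>f\<close>
        applies. Enlarging \<open>f\<close> to \<open>h\<close> inside the nonnegative transition
        integral then yields the inequality.\<close>
      have "(LINT y:B|?L. h y) = (LINT y:B|?L. f y)"
        unfolding set_lebesgue_integral_def using B(2)
        by (intro Bochner_Integration.integral_cong) (auto simp: h_def A_def indicator_def)
      then have "exp (l * s) * (LINT y:B|?L. h y)
          = (LINT y|?L. measure (P y) {w \<in> space M. x s w \<in> B} * f y)"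
        using transfer[OF s B(1)] by simp
      also have "\<dots> \<le> (LINT y|?L. measure (P y) {w \<in> space M. x s w \<in> B} * h y)"
        using h0 by (intro integral_mono int f h mult_left_mono) auto
      finally have "ennreal (exp (l * s)) * emeasure \<rho> B
          \<le> ennreal (LINT y|?L. measure (P y) {w \<in> space M. x s w \<in> B} * h y)"
        by (simp add: \<rho>_B[OF B(1)] ennreal_mult'[symmetric] ennreal_leI)
      also have "\<dots> = (\<integral>\<^sup>+y. ennreal (measure (P y) {w \<in> space M. x s w \<in> B} * h y) \<partial>?L)"
        using int[OF h] h0 by (intro nn_integral_eq_integral[symmetric]) auto
      also have "\<dots> = (\<integral>\<^sup>+y. ennreal (h y) * emeasure (P y) {w \<in> space M. x s w \<in> B} \<partial>?L)"
        using h0 by (intro nn_integral_cong) (simp add: spL law_emeasure ennreal_mult mult.commute)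
      also have "\<dots> = (\<integral>\<^sup>+z. emeasure (P z) {w \<in> space M. x s w \<in> B} \<partial>\<rho>)"
        by (rule \<rho>_int[OF law_event_measurable[OF E], symmetric])
      finally show ?thesis .
    qed
    \<comment> \<open>The maximum with 1 keeps \<open>D\<close> positive whatever the sign of
      \<open>C\<close>, so division by it is safe.\<close>
    define D where "D = max 1 C"
    define m where "m = measure lebesgue X"
    have m1: "emeasure lebesgue X = ennreal m"
      unfolding m_def using X(3) by (intro emeasure_eq_ennreal_measure less_imp_neq) (simp only: infinity_ennreal_def)
    have m: "0 < m" using X(2) unfolding m1 by simp
    have hD: "AE y in ?L. h y \<le> D" using bnd by eventually_elim (auto simp: h_def D_def)
    have D: "0 < D" by (simp add: D_def)
    \<comment> \<open>The start from \<open>\<rho>\<close> has mass \<open>a\<close>, and its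
      density is at most \<open>D\<close>. Comparison with Lebesgue measure costs the factor
      \<open>D\<close>, and normalization costs the volume \<open>m\<close>.\<close>
    have "a / (D * m) * exp (l * (real n * s))
        \<le> measure Q (G s n)"
      if s: "0 \<le> s" for s n
    proof -
      have G: "G s n \<in> sets M" by (rule G_event[OF s])
      \<comment> \<open>With \<open>X\<close> as the final test set, the condition on the last
        position is vacuous.\<close>
      have GX: "G s n \<inter> {w \<in> space M. x (real n * s) w \<in> X} = G s n"
      proof (intro Int_absorb2 subsetI CollectI conjI)
        fix w assume "w \<in> G s n"
        then show "w \<in> space M" using sets.sets_into_space[OF G] by blast
        then show "x (real n * s) w \<in> X" using s by (intro state_in) simp
      qed
      have e: "exp (l * (real n * s)) = exp (l * s) ^ n"
        by (simp only: exp_of_nat_mult[symmetric] mult.left_commute)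
      have "ennreal (exp (l * (real n * s)) * a) = ennreal (exp (l * s)) ^ n * emeasure \<rho> X"
        unfolding e \<rho>_X using a0 by (simp add: ennreal_power ennreal_mult)
      also have "\<dots> \<le> emeasure (\<rho> \<bind> P) (G s n)"
        using survival_lower_bound[OF \<rho> ne s A supp one_step[OF s] XR, of n]
        unfolding G_def[symmetric] GX .
      also have "\<dots> = (\<integral>\<^sup>+y. ennreal (h y) * emeasure (P y) (G s n) \<partial>?L)"
        using emeasure_bind[OF _ P\<rho> G] ne sets_eq_imp_space_eq[OF \<rho>]
        by (simp add: space_restrict_space \<rho>_int[OF law_event_measurable[OF G]])
      also have "\<dots> \<le> (\<integral>\<^sup>+y. ennreal D * emeasure (P y) (G s n) \<partial>?L)"
        using hD by (intro nn_integral_mono_AE) (auto intro!: mult_right_mono ennreal_leI)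
      also have "\<dots> = ennreal D * (\<integral>\<^sup>+y. emeasure (P y) (G s n) \<partial>?L)"
        by (rule nn_integral_cmult[OF law[OF G]])
      also have "(\<integral>\<^sup>+y. emeasure (P y) (G s n) \<partial>?L) = emeasure lebesgue X * emeasure Q (G s n)"
        unfolding Q[OF G] m1 using m
        by (simp add: ennreal_times_divide mult.commute[of "ennreal m"] ennreal_mult_divide_eq)
      also have "ennreal D * (emeasure lebesgue X * emeasure Q (G s n)) = ennreal (D * m * measure Q (G s n))"
        unfolding m1 using D m by (simp add: Q.emeasure_eq_measure ennreal_mult mult_ac)
      finally have "exp (l * (real n * s)) * a \<le> D * m * measure Q (G s n)"
        using D m by (subst (asm) ennreal_le_iff) auto
      then show ?thesis using D m by (simp add: field_simps)
    qed
    then show ?thesis using a D m by (intro exI[of _ "a / (D * m)"]) auto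
  qed
  then obtain c where c: "0 < c" and
    ge: "\<And>s n. 0 \<le> s \<Longrightarrow> c * exp (l * (real n * s))
      \<le> measure Q (G s n)" by blast
  have "c * exp (l * t) \<le> measure (completion Q) {w \<in> space Q. \<forall>r\<in>{0..t}. x r w \<in> A}"
    if t: "0 < t" for t
  proof (rule measure_all_times_ge[where X=X])
    show "finite_measure Q" by unfold_locales
    show "AE w in Q. continuous_on {0..} (\<lambda>t. x t w)" using cont unfolding Q_def .
    show "closedin (top_of_set X) A" using cl by (simp add: A_def)
    show "0 < t" by fact
    show "x r w \<in> X" if "0 \<le> r" "w \<in> space Q" for r w using that state_in by (simp add: spQ)
    show "{w \<in> space Q. x r w \<in> A} \<in> sets Q" if "0 \<le> r" for r
      using state_event[OF that A] by (simp add: spQ setsQ)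
    show "c * exp (l * t) \<le> measure Q {w \<in> space Q. \<forall>k\<le>2 ^ m. x (real k * (t / 2 ^ m)) w \<in> A}" for m
      using ge[of "t / 2 ^ m" "2 ^ m"] t unfolding G_def[symmetric] spQ by simp
  qed
  then show ?thesis using escape_rate_le[OF c] unfolding Q_def A_def by blast
qed

end

section \<open>From the transfer operator to integral identities\<close>

text \<open>Replacing \<open>T f\<close> by \<open>c * f\<close> under the integral eliminates the
  operator and leaves a relation between \<open>f\<close> and the laws \<open>P y\<close>
  alone.\<close>

lemma transfer_operator_eigenfunction:
  assumes T: "transfer_operator X M P x t T"
    and f: "integrable (lebesgue_on X) f"
    and eig: "AE y in lebesgue_on X. T f y = c * f y"
    and B: "B \<in> sets (restrict_space borel X)"
  shows "c * (LINT y:B|lebesgue_on X. f y)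
    = (LINT y|lebesgue_on X. measure (P y) {w \<in> space M. x t w \<in> B} * f y)"
proof -
  have [measurable]: "B \<in> sets (lebesgue_on X)" by (rule sets_lebesgue_on_if_borel[OF B])
  have Tf: "integrable (lebesgue_on X) (T f)"
    and eq: "(LINT y:B|lebesgue_on X. T f y)
      = (LINT y|lebesgue_on X. measure (P y) {w \<in> space M. x t w \<in> B} * f y)"
    using T f B unfolding transfer_operator_def by auto
  have [measurable]: "f \<in> borel_measurable (lebesgue_on X)" "T f \<in> borel_measurable (lebesgue_on X)"
    using f Tf by auto
  have "(LINT y:B|lebesgue_on X. T f y) = (LINT y:B|lebesgue_on X. c * f y)"
    unfolding set_lebesgue_integral_def using eig by (intro integral_cong_AE) auto
  then show ?thesis using eq by simp
qed

text \<open>Apply the defining property to the constant density 1, integrable since \<open>X\<close>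
  has finite measure. The integral of its image over the null set \<open>B\<close> vanishes, so the
  nonnegative transition probability has integral 0.\<close>

lemma (in homogeneous_markov_process) transfer_operator_null:
  assumes T: "transfer_operator X M P x t T" and t: "0 \<le> t"
    and X: "X \<in> sets lebesgue" "emeasure lebesgue X < \<infinity>"
    and B: "B \<in> sets (restrict_space borel X)" "emeasure lebesgue B = 0"
  shows "AE y in lebesgue_on X. emeasure (P y) {w \<in> space M. x t w \<in> B} = 0"
proof -
  let ?E = "{w \<in> space M. x t w \<in> B}"
  have BX: "B \<subseteq> X" using sets.sets_into_space[OF B(1)] by (simp add: space_restrict_space)
  have B_null: "B \<in> null_sets (lebesgue_on X)"
    using sets_lebesgue_on_if_borel[OF B(1)] B(2) BX X(1) by (intro null_setsI) (auto simp: emeasure_restrict_space)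
  have fin: "finite_measure (lebesgue_on X)"
    using X by (intro finite_measureI) (simp add: emeasure_restrict_space space_restrict_space)
  then have one: "integrable (lebesgue_on X) (\<lambda>_. 1::real)" by (simp add: finite_measure.integrable_const)
  have E: "?E \<in> sets M" by (rule state_event[OF t B(1)])
  have "(\<lambda>y. enn2real (emeasure (P y) ?E)) \<in> borel_measurable (lebesgue_on X)"
    using measurable_from_lebesgue_on[OF law_event_measurable[OF E]] by simp
  then have meas: "(\<lambda>y. measure (P y) ?E) \<in> borel_measurable (lebesgue_on X)"
    by (simp add: measure_def)
  have int: "integrable (lebesgue_on X) (\<lambda>y. measure (P y) ?E)"
    using meas law_prob_space(1) prob_space.prob_le_1
    by (intro finite_measure.integrable_const_bound[OF fin, where B=1] AE_I2) (auto simp: space_restrict_space)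
  have "(LINT y|lebesgue_on X. measure (P y) ?E) = (LINT y:B|lebesgue_on X. T (\<lambda>_. 1) y)"
    using T one B(1) unfolding transfer_operator_def by simp
  also have "\<dots> = (LINT y|lebesgue_on X. 0)"
    unfolding set_lebesgue_integral_def
  proof (rule integral_cong_AE)
    show "(\<lambda>y. indicat_real B y *\<^sub>R T (\<lambda>_. 1) y) \<in> borel_measurable (lebesgue_on X)"
      using T one sets_lebesgue_on_if_borel[OF B(1)] unfolding transfer_operator_def by auto
    show "AE y in lebesgue_on X. indicat_real B y *\<^sub>R T (\<lambda>_. 1) y = 0"
      using AE_not_in[OF B_null] by eventually_elim simp
  qed simp
  finally have "(LINT y|lebesgue_on X. measure (P y) ?E) = 0" by simp
  then have "AE y in lebesgue_on X. measure (P y) ?E = 0"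
    using integral_nonneg_eq_0_iff_AE[OF int] by simp
  then show ?thesis
    using AE_space
  proof eventually_elim
    case (elim y)
    then have "prob_space (P y)" using law_prob_space(1) by (simp add: space_restrict_space)
    then show ?case using elim(1)
      by (simp add: finite_measure.emeasure_eq_measure prob_space.finite_measure)
  qed
qed

theorem theorem16:
  fixes X :: "'a::euclidean_space set"
    and M :: "'w measure"
    and P :: "'a \<Rightarrow> 'w measure"
    and x :: "real \<Rightarrow> 'w \<Rightarrow> 'a"
    and K :: "real \<Rightarrow> real \<Rightarrow> 'a \<Rightarrow> 'a measure"
    and T :: "real \<Rightarrow> ('a \<Rightarrow> real) \<Rightarrow> ('a \<Rightarrow> real)"
    and f :: "'a \<Rightarrow> real"
    and lam :: real
  assumes "bounded X" and "X \<in> sets lebesgue" and "0 < measure lebesgue X"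
    and "homogeneous_markov_process X M P x K"
    and "AE w in lebesgue_start X P. continuous_on {0..} (\<lambda>t. x t w)"
    and "\<And>t. 0 \<le> t \<Longrightarrow> transfer_operator X M P x t (T t)"
    and "integrable (lebesgue_on X) f"
    and "\<exists>C. AE y in lebesgue_on X. \<bar>f y\<bar> \<le> C"
    and "\<And>t. 0 \<le> t \<Longrightarrow> AE y in lebesgue_on X. T t f y = exp (lam * t) * f y"
    and "lam < 0"
  shows "(closedin (top_of_set X) {y \<in> X. f y \<ge> 0} \<longrightarrow>
            escape_rate (lebesgue_start X P) x {y \<in> X. f y \<ge> 0} \<le> ereal (- lam))
       \<and> (closedin (top_of_set X) {y \<in> X. - f y \<ge> 0} \<longrightarrow>
            escape_rate (lebesgue_start X P) x {y \<in> X. - f y \<ge> 0} \<le> ereal (- lam))"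
proof -
  interpret homogeneous_markov_process X M P x K by fact
  have pos: "0 < emeasure lebesgue X"
    using assms(3) by (metis measure_eq_0_null_sets null_setsI assms(2) less_irrefl not_gr_zero)
  \<comment> \<open>Boundedness of \<open>X\<close> enters as finiteness of its volume.\<close>
  have fin: "emeasure lebesgue X < \<infinity>"
    using bounded_set_imp_lmeasurable[OF assms(1,2)] unfolding fmeasurable_def by blast
  obtain C where C: "AE y in lebesgue_on X. \<bar>f y\<bar> \<le> C" using assms(8) by blast
  note transfer = transfer_operator_eigenfunction[OF assms(6) assms(7) assms(9)]
  note null = transfer_operator_null[OF assms(6) _ assms(2) fin]
  have "escape_rate (lebesgue_start X P) x {y \<in> X. f y \<ge> 0} \<le> ereal (- lam)"
    if "closedin (top_of_set X) {y \<in> X. f y \<ge> 0}"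
    by (rule escape_rate_nonneg_set_le[OF assms(2) pos fin assms(5,7) C that transfer null assms(10)])
  \<comment> \<open>The other sign is the same lemma for the negative of \<open>f\<close>. Its
    identity follows by negating both integrals, without appeal to linearity of
    \<open>T t\<close>.\<close>
  moreover have "escape_rate (lebesgue_start X P) x {y \<in> X. - f y \<ge> 0} \<le> ereal (- lam)"
    if "closedin (top_of_set X) {y \<in> X. - f y \<ge> 0}"
  proof (rule escape_rate_nonneg_set_le[OF assms(2) pos fin assms(5) _ _ that _ null assms(10)])
    show "integrable (lebesgue_on X) (\<lambda>y. - f y)" using assms(7) by simp
    show "AE y in lebesgue_on X. \<bar>- f y\<bar> \<le> C" using C by simp
    show "exp (lam * t) * (LINT y:B|lebesgue_on X. - f y)
        = (LINT y|lebesgue_on X. measure (P y) {w \<in> space M. x t w \<in> B} * - f y)"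
      if "0 \<le> t" "B \<in> sets (restrict_space borel X)" for t B
      using transfer[OF that(1) that(1) that(2)] by (simp add: set_lebesgue_integral_def)
  qed
  ultimately show ?thesis by blast
qed

end
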